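(* Let $\ell:[1,\infty)\to(0,\infty)$ be measurable, locally bounded and slowly varying at infinity, put $L(x)=\sum_{1\le j\le x}\ell(j)/j$, and assume $L(x)\to\infty$ as $x\to\infty$. Let $(\lambda_N)_{N\ge1}$ be positive numbers with $\lambda_N\to0$ and $N\lambda_N\to\lambda_*\in[0,\infty]$ as $N\to\infty$. For $x>0$ set \[ Q_N(x)=\sum_{j=1}^{\lfloor Nx\rfloor}e^{-\lambda_N j}\frac{\ell(j)}{j},\qquad Q_N=Q_N(1). \] Then for every $c>0$, \[ \frac{Q_N(c)}{Q_N}\longrightarrow 1\qquad(N\to\infty). \] Moreover, as $N\to\infty$, \[ Q_N\sim L(N)\ \text{ if }0\le\lambda_*<\infty,\qquad Q_N\sim L(1/\lambda_N)\ \text{ if }\lambda_*=\infty . \] Equivalently, $Q_N\sim L\bigl(N\wedge\lambda_N^{-1}\bigr)$.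
   Context: A measurable function $\ell:[1,\infty)\to(0,\infty)$ is slowly varying at infinity if $\ell(cx)/\ell(x)\to1$ as $x\to\infty$ for every $c>0$. The notation $u_N\sim v_N$ means $u_N/v_N\to1$; $a\wedge b=\min\{a,b\}$; $\lfloor\cdot\rfloor$ is the integer part. *)

theory Defs
  imports "HOL-Analysis.Analysis"
begin

text \<open>Functions on \<open>[1,\<infinity>)\<close> are total functions on the reals, of which only the values
  on \<open>{1..}\<close> are constrained. Measurability is Lebesgue measurability, which
  includes Borel measurability.\<close>

definition slowly_varying :: "(real \<Rightarrow> real) \<Rightarrow> bool" where
  "slowly_varying f \<longleftrightarrow>
     f \<in> borel_measurable (lebesgue_on {1..}) \<and>
     (\<forall>x\<ge>1. f x > 0) \<and>
     (\<forall>c>0. ((\<lambda>x. f (c * x) / f x) \<longlongrightarrow> 1) at_top)"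

definition locally_bounded_on :: "real set \<Rightarrow> (real \<Rightarrow> real) \<Rightarrow> bool" where
  "locally_bounded_on S f \<longleftrightarrow> (\<forall>K. compact K \<and> K \<subseteq> S \<longrightarrow> bounded (f ` K))"

definition L :: "(real \<Rightarrow> real) \<Rightarrow> real \<Rightarrow> real" where
  "L ell x = (\<Sum>j | 1 \<le> j \<and> real j \<le> x. ell (real j) / real j)"

definition Q :: "(real \<Rightarrow> real) \<Rightarrow> (nat \<Rightarrow> real) \<Rightarrow> nat \<Rightarrow> real \<Rightarrow> real" where
  "Q ell lam N x =
     (\<Sum>j = 1..nat \<lfloor>real N * x\<rfloor>. exp (- lam N * real j) * (ell (real j) / real j))"

end

theory Submission
  imports Defs
begin

text \<open>
  The uniform convergence theorem for slowly varying functions makes \<open>\<ell>\<close> nearly constant on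
  windows \<open>[x/b, x]\<close>; comparing \<open>L\<close> there with a harmonic sum of size \<open>log b\<close> gives
  \<open>\<ell>(x) = o(L(x))\<close>, and then \<open>L(b x) \<sim> L(x)\<close> for every \<open>b\<close>. With \<open>m = min N (1/\<lambda>\<^sub>N)\<close>, the terms
  \<open>j \<le> \<delta> m\<close> of \<open>Q\<^sub>N(c)\<close> contribute at least \<open>exp (-\<delta>) L(\<delta> m)\<close>, while the terms \<open>j > m\<close> contribute
  \<open>o(L(m))\<close>: by \<open>L(c m) \<sim> L(m)\<close> if \<open>m = N\<close>, and otherwise by the damping \<open>exp (-j/m)\<close>, which beats
  the at most linear growth of \<open>\<ell>\<close>. So \<open>Q\<^sub>N(c) \<sim> L(m)\<close> for every \<open>c > 0\<close>, which yields all the claims.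
\<close>

section \<open>Uniform convergence theorem for slowly varying functions\<close>

lemma slowly_varying_pos: "slowly_varying f \<Longrightarrow> x \<ge> 1 \<Longrightarrow> f x > 0"
  by (auto simp: slowly_varying_def)

text \<open>Extending \<open>f\<close> by zero to the whole line makes the scaling rule for Lebesgue
  measurability applicable; since \<open>x * s \<ge> 1\<close> on the interval, the extension agrees
  with \<open>f\<close> there.\<close>

lemma borel_measurable_scaled_on:
  fixes f :: "real \<Rightarrow> real"
  assumes "f \<in> borel_measurable (lebesgue_on {1..})" and "x \<ge> 1" "a \<ge> 1"
  shows "(\<lambda>s. f (x * s)) \<in> borel_measurable (lebesgue_on {a..b})"
proof -
  define g where "g = (\<lambda>y. if y \<in> {1..} then f y else 0)"
  have "g \<in> borel_measurable lebesgue"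
    unfolding g_def using assms(1) by (subst borel_measurable_if) auto
  then have "(\<lambda>s. g (x *\<^sub>R s)) \<in> borel_measurable lebesgue"
    using assms(2) by (intro measurable_compose[OF lebesgue_measurable_scaling])
  then have *: "(\<lambda>s. g (x * s)) \<in> borel_measurable (lebesgue_on {a..b})"
    by (simp add: measurable_restrict_space1)
  have "g (x * s) = f (x * s)" if "s \<in> {a..b}" for s
    using that assms mult_mono[of 1 x 1 s] by (auto simp: g_def)
  then show ?thesis
    by (intro measurable_cong[THEN iffD1, OF _ *]) auto
qed

text \<open>Truncation at 1 supplies a constant majorant for dominated convergence and preserves the
  triangle inequality. Any value below 1 is the genuine logarithmic increment.\<close>

definition log_deviation :: "(real \<Rightarrow> real) \<Rightarrow> real \<Rightarrow> real \<Rightarrow> real" where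
  "log_deviation f x s = min 1 \<bar>ln (f (x * s)) - ln (f x)\<bar>"

lemma log_deviation_integrable:
  assumes "f \<in> borel_measurable (lebesgue_on {1..})" "x \<ge> 1" "a \<ge> 1"
  shows "log_deviation f x integrable_on {a..b}"
proof (rule measurable_bounded_by_integrable_imp_integrable)
  show "log_deviation f x \<in> borel_measurable (lebesgue_on {a..b})"
    using borel_measurable_scaled_on[OF assms, of b] unfolding log_deviation_def by measurable
  show "(\<lambda>_. 1::real) integrable_on {a..b}" by (rule integrable_const_ivl)
qed (auto simp: log_deviation_def)

text \<open>Slow variation is exactly pointwise convergence of the integrand to 0, so dominated
  convergence applies along every sequence tending to infinity.\<close>

lemma log_deviation_integral_tendsto_0:
  assumes "slowly_varying f"
  shows "((\<lambda>x. integral {1..b} (log_deviation f x)) \<longlongrightarrow> 0) at_top"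
proof (rule tendsto_at_topI_sequentially)
  fix X :: "nat \<Rightarrow> real"
  assume X: "filterlim X at_top sequentially"
  note pos = slowly_varying_pos[OF assms]
  obtain M where M: "X n \<ge> 1" if "n \<ge> M" for n
    using X by (auto simp: filterlim_at_top eventually_sequentially)
  \<comment> \<open>The shift by \<open>M\<close> keeps every argument in the range where
    \<open>f\<close> is known to be positive and measurable.\<close>
  let ?Y = "\<lambda>n. X (n + M)"
  have Y: "filterlim ?Y at_top sequentially"
    by (rule filterlim_compose[OF X]) (rule filterlim_add_const_nat_at_top)
  have "(\<lambda>n. integral {1..b} (log_deviation f (?Y n))) \<longlonglongrightarrow> integral {1..b} (\<lambda>_. 0)"
  proof (rule dominated_convergence(2))
    show "log_deviation f (?Y n) integrable_on {1..b}" for n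
      using assms M by (intro log_deviation_integrable) (auto simp: slowly_varying_def)
    show "(\<lambda>_. 1::real) integrable_on {1..b}" by (rule integrable_const_ivl)
    show "norm (log_deviation f (?Y n) s) \<le> 1" for n s by (auto simp: log_deviation_def)
    fix s assume s: "s \<in> {1..b}"
    have "((\<lambda>x. f (s * x) / f x) \<longlongrightarrow> 1) at_top" using assms s by (auto simp: slowly_varying_def)
    then have "((\<lambda>x. min 1 \<bar>ln (f (s * x) / f x)\<bar>) \<longlongrightarrow> min 1 \<bar>ln 1\<bar>) at_top"
      by (intro tendsto_intros) auto
    then have *: "(\<lambda>n. min 1 \<bar>ln (f (s * ?Y n) / f (?Y n))\<bar>) \<longlonglongrightarrow> 0"
      using filterlim_compose[OF _ Y] by fastforce
    have "min 1 \<bar>ln (f (s * ?Y n) / f (?Y n))\<bar> = log_deviation f (?Y n) s" for n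
    proof -
      have "?Y n \<ge> 1" using M by auto
      moreover have "s * ?Y n \<ge> 1" using s calculation mult_mono[of 1 s 1 "?Y n"] by auto
      ultimately show ?thesis
        using pos[of "?Y n"] pos[of "s * ?Y n"] by (simp add: log_deviation_def ln_div mult.commute)
    qed
    with * show "(\<lambda>n. log_deviation f (?Y n) s) \<longlonglongrightarrow> 0" by simp
  qed
  then show "(\<lambda>n. integral {1..b} (log_deviation f (X n))) \<longlonglongrightarrow> 0"
    using LIMSEQ_offset by fastforce
qed

text \<open>
  Average the triangle inequality through \<open>f (x * u)\<close> over \<open>u \<in> [b, 2b]\<close>: the point \<open>x * u\<close> is
  reached from \<open>x * t\<close> by the factor \<open>u / t \<in> [1, 2b]\<close>. This turns pointwise into uniform convergence.
\<close>
lemma log_deviation_le_integrals: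
  assumes sv: "slowly_varying f" and "x \<ge> 1" "t \<in> {1..b}"
  shows "b * log_deviation f x t
    \<le> integral {1..2*b} (log_deviation f x) + b * integral {1..2*b} (log_deviation f (x * t))"
proof -
  have meas: "f \<in> borel_measurable (lebesgue_on {1..})" using sv by (auto simp: slowly_varying_def)
  let ?p = "log_deviation f x" and ?q = "log_deviation f (x * t)"
  have t: "t \<ge> 1" "t \<le> b" "b \<ge> 1" using assms by auto
  have xt: "x * t \<ge> 1" using t assms mult_mono[of 1 x 1 t] by auto
  have ip: "?p integrable_on {1..2*b}" "?p integrable_on {b..2*b}"
    using log_deviation_integrable[OF meas] assms t by auto
  have iq: "?q integrable_on {1..2*b}" "?q integrable_on {b/t..2*b/t}"
    using log_deviation_integrable[OF meas xt] t by auto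
  have "(\<lambda>u. u * t) ` {b/t..2*b/t} = {b..2*b}"
    using t by (simp add: image_mult_atLeastAtMost mult.commute[of _ t])
  then have "((\<lambda>u. ?q (u / t)) has_integral (t * integral {b/t..2*b/t} ?q)) {b..2*b}"
    using has_integral_stretch_real[OF integrable_integral[OF iq(2)], of "1/t"] t by simp
  then have sc: "(\<lambda>u. ?q (u/t)) integrable_on {b..2*b}"
      "integral {b..2*b} (\<lambda>u. ?q (u/t)) = t * integral {b/t..2*b/t} ?q"
    by (auto simp: has_integral_iff)
  have nn: "log_deviation f y s \<ge> 0" for y s by (auto simp: log_deviation_def)
  have "b * ?p t = integral {b..2*b} (\<lambda>_. ?p t)" using t by simp
  also have "\<dots> \<le> integral {b..2*b} (\<lambda>u. ?p u + ?q (u/t))"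
  proof (intro integral_le integrable_add ip sc integrable_const_ivl)
    fix u
    show "?p t \<le> ?p u + ?q (u/t)" using t by (auto simp: log_deviation_def min_def)
  qed
  also have "\<dots> = integral {b..2*b} ?p + t * integral {b/t..2*b/t} ?q"
    using ip sc by (simp add: integral_add)
  \<comment> \<open>For \<open>1 \<le> t \<le> b\<close> the interval from \<open>b/t\<close> to
    \<open>2*b/t\<close> lies inside \<open>{1..2*b}\<close>, so one fixed interval serves all
    \<open>t\<close>.\<close>
  also have "\<dots> \<le> integral {1..2*b} ?p + b * integral {1..2*b} ?q"
  proof (intro add_mono mult_mono)
    show "integral {b..2*b} ?p \<le> integral {1..2*b} ?p"
      using ip t nn by (intro integral_subset_le) auto
    show "integral {b/t..2*b/t} ?q \<le> integral {1..2*b} ?q"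
      using iq t nn by (intro integral_subset_le) (auto simp: field_simps intro: order_trans[OF _ mult_left_mono[of 1 t]])
  qed (use t nn iq in \<open>auto intro!: integral_nonneg\<close>)
  finally show ?thesis .
qed

text \<open>Since \<open>x * t \<ge> x\<close>, both integrals in the averaged inequality are small
  as soon as \<open>x\<close> is large, with a threshold independent of \<open>t\<close>.\<close>

lemma slowly_varying_uniform:
  assumes sv: "slowly_varying f" and "\<epsilon> > 0" "b \<ge> 1"
  shows "\<forall>\<^sub>F x in at_top. \<forall>t\<in>{1..b}. \<bar>ln (f (x * t)) - ln (f x)\<bar> < \<epsilon>"
proof -
  \<comment> \<open>\<open>d < 1\<close> ensures that a truncated deviation below \<open>d\<close>
    is an untruncated one.\<close>
  define d where "d = min 1 \<epsilon> / 2"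
  have d: "d > 0" "d < 1" "d < \<epsilon>" using assms by (auto simp: d_def)
  have "\<forall>\<^sub>F x in at_top. integral {1..2*b} (log_deviation f x) < d / 2"
    using order_tendstoD(2)[OF log_deviation_integral_tendsto_0[OF sv, of "2*b"], of "d/2"] d by auto
  then obtain X where X: "\<And>x. x \<ge> X \<Longrightarrow> integral {1..2*b} (log_deviation f x) < d / 2"
    by (auto simp: eventually_at_top_linorder)
  show ?thesis
    using eventually_ge_at_top[of "max 1 X"]
  proof eventually_elim
    case (elim x)
    show ?case
    proof
      fix t assume t: "t \<in> {1..b}"
      have "x \<le> x * t" using t elim mult_left_mono[of 1 t x] by auto
      then have "integral {1..2*b} (log_deviation f (x * t)) < d/2" using elim by (intro X) linarith
      then have "b * log_deviation f x t < d/2 + b * (d/2)"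
        using log_deviation_le_integrals[OF sv _ t, of x] elim X[of x] assms(3)
          mult_strict_left_mono[of "integral {1..2*b} (log_deviation f (x * t))" "d/2" b] by linarith
      also have "\<dots> \<le> b * d" using assms(3) d mult_right_mono[of 1 b "d/2"] by linarith
      finally have "log_deviation f x t < d" using assms(3) by auto
      then show "\<bar>ln (f (x * t)) - ln (f x)\<bar> < \<epsilon>" using d by (auto simp: log_deviation_def)
    qed
  qed
qed

section \<open>Comparison of values on windows and linear growth\<close>

lemma slowly_varying_ratio_bounds:
  assumes sv: "slowly_varying f" and "b \<ge> 1"
  shows "\<forall>\<^sub>F x in at_top. \<forall>y\<in>{x..b*x}. f y \<le> 2 * f x \<and> f x \<le> 2 * f y"
proof -
  have "ln 2 > (0::real)" by simp
  from slowly_varying_uniform[OF sv this assms(2)] eventually_ge_at_top[of 1]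
  show ?thesis
  proof eventually_elim
    case (elim x)
    show ?case
    proof
      fix y assume y: "y \<in> {x..b*x}"
      have "y / x \<in> {1..b}" using y elim by (auto simp: field_simps)
      then have "\<bar>ln (f (x * (y/x))) - ln (f x)\<bar> < ln 2" using elim by blast
      then have *: "\<bar>ln (f y) - ln (f x)\<bar> < ln 2" using elim by auto
      have pos: "f x > 0" "f y > 0" using sv elim y by (auto intro: slowly_varying_pos)
      then have "ln (f y) \<le> ln (2 * f x)" "ln (f x) \<le> ln (2 * f y)"
        using * by (auto simp: ln_mult)
      then show "f y \<le> 2 * f x \<and> f x \<le> 2 * f y" using pos by auto
    qed
  qed
qed

text \<open>Halving \<open>y\<close> costs a factor 2 in \<open>f\<close> and divides
  \<open>y / x\<close> by 2 as well, so repeated halving down to \<open>[x, 2x]\<close> gives a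
  linear bound; the leading 2 pays for the last window.\<close>

lemma slowly_varying_growth:
  assumes sv: "slowly_varying f"
  shows "\<forall>\<^sub>F x in at_top. \<forall>y\<ge>x. f y \<le> 2 * (y / x) * f x"
proof -
  have "\<exists>X. \<forall>x\<ge>X. \<forall>y\<in>{x..2*x}. f y \<le> 2 * f x \<and> f x \<le> 2 * f y"
    using slowly_varying_ratio_bounds[OF sv, of 2] by (simp add: eventually_at_top_linorder)
  then obtain X where X: "\<And>x y. x \<ge> X \<Longrightarrow> y \<in> {x..2*x} \<Longrightarrow> f y \<le> 2 * f x" by blast
  show ?thesis
    using eventually_ge_at_top[of "max 1 X"]
  proof eventually_elim
    case (elim x)
    have pos: "f x > 0" using sv elim by (auto intro: slowly_varying_pos)
    have dyadic: "f y \<le> 2 * (y / x) * f x" if "x \<le> y" "y \<le> 2 ^ n * x" for y n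
      using that
    proof (induction n arbitrary: y)
      case 0
      then show ?case using pos elim by auto
    next
      case (Suc n)
      show ?case
      proof (cases "y \<le> 2 * x")
        case True
        have "f y \<le> 2 * f x" using X[of x y] elim Suc True by auto
        also have "\<dots> \<le> 2 * (y/x) * f x"
          using pos elim Suc.prems by (intro mult_right_mono) (auto simp: field_simps)
        finally show ?thesis .
      next
        case False
        then have "f (y/2) \<le> 2 * (y / 2 / x) * f x" using Suc by (intro Suc.IH) auto
        moreover have "f y \<le> 2 * f (y/2)" using X[of "y/2" y] False elim by auto
        ultimately have "f y \<le> 2 * (2 * (y / 2 / x) * f x)" by linarith
        then show ?thesis by simp
      qed
    qed
    show ?case
    proof (intro allI impI)
      fix y assume "x \<le> y"
      obtain n :: nat where "y / x < 2 ^ n" using real_arch_pow[of 2 "y/x"] by auto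
      then have "y \<le> 2 ^ n * x" using elim by (auto simp: field_simps)
      then show "f y \<le> 2 * (y / x) * f x" using dyadic \<open>x \<le> y\<close> by blast
    qed
  qed
qed

section \<open>The partial sums \<open>L\<close> and exponentially damped tails\<close>

lemma finite_nats_below: "finite {j::nat. P j \<and> real j \<le> x}"
  by (rule finite_subset[of _ "{..nat \<lfloor>x\<rfloor>}"]) (auto simp: le_nat_floor)

lemma L_diff_eq:
  assumes "0 \<le> x" "x \<le> y"
  shows "L f y - L f x = (\<Sum>j | x < real j \<and> real j \<le> y. f (real j) / real j)"
proof -
  have "{j. 1 \<le> j \<and> real j \<le> y} = {j. 1 \<le> j \<and> real j \<le> x} \<union> {j. x < real j \<and> real j \<le> y}"
    using assms by (auto simp: not_less Suc_le_eq intro: ccontr)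
  then have "L f y = L f x + (\<Sum>j | x < real j \<and> real j \<le> y. f (real j) / real j)"
    unfolding L_def by (simp add: sum.union_disjoint finite_nats_below disjoint_iff)
  then show ?thesis by simp
qed

lemma slowly_varying_term_nonneg: "slowly_varying f \<Longrightarrow> f (real j) / real j \<ge> 0"
  using slowly_varying_pos[of f "real j"] by (cases "j = 0") auto

lemma L_mono:
  assumes "slowly_varying f" "x \<le> y"
  shows "L f x \<le> L f y"
  unfolding L_def using assms
  by (intro sum_mono2 finite_nats_below) (auto simp: slowly_varying_term_nonneg)

text \<open>The inequality \<open>ln ((k + 1) / k) \<le> 1 / k\<close> telescopes. The
  \<open>x + 1\<close> in the denominator absorbs the rounding of the endpoints.\<close>

lemma ln_le_sum_inverse:
  assumes "0 < x" "x \<le> y"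
  shows "ln (y / (x + 1)) \<le> (\<Sum>j | x < real j \<and> real j \<le> y. 1 / real j)"
proof -
  define m n where "m = nat \<lfloor>x\<rfloor>" and "n = nat \<lfloor>y\<rfloor>"
  have mn: "real m \<le> x" "y < real n + 1" "m \<le> n"
    using assms by (auto simp: m_def n_def intro!: nat_mono floor_mono)
  have "{j. x < real j \<and> real j \<le> y} = {m<..n}"
    using assms by (auto simp: m_def n_def le_nat_iff le_floor_iff nat_less_iff floor_less_iff)
  moreover have "ln (real (n + 1) / real (m + 1)) \<le> (\<Sum>j\<in>{m<..n}. 1 / real j)"
    using mn(3)
  proof (induction n rule: dec_induct)
    case (step n)
    have "ln (real (n + 2) / real (n + 1)) \<le> 1 / real (n + 1)"
      using ln_le_minus_one[of "real (n + 2) / real (n + 1)"] by (simp add: field_simps)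
    moreover have "{m<..Suc n} = insert (Suc n) {m<..n}" using step by auto
    ultimately show ?case using step by (simp add: ln_div)
  qed simp
  moreover have "ln (y / (x + 1)) \<le> ln (real (n + 1) / real (m + 1))"
    using assms mn by (intro ln_mono divide_pos_pos frac_le) auto
  ultimately show ?thesis by simp
qed

text \<open>On the window from \<open>x / b\<close> to \<open>x\<close> all values of
  \<open>f\<close> are at least \<open>f x / 4\<close>, while the harmonic sum there is at least
  \<open>ln (b / 2)\<close>, which is as large as desired for large \<open>b\<close>.\<close>

lemma slowly_varying_le_L:
  assumes sv: "slowly_varying f" and "\<epsilon> > 0"
  shows "\<forall>\<^sub>F x in at_top. f x \<le> \<epsilon> * L f x"
proof -
  \<comment> \<open>This choice gives \<open>ln (b / 2) / 4 = 1 / \<epsilon>\<close>; the 2 pays for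
    replacing \<open>?y + 1\<close> by \<open>2 * ?y\<close> below.\<close>
  define b where "b = 2 * exp (4 / \<epsilon>)"
  have b: "b \<ge> 1" "ln (b / 2) = 4 / \<epsilon>"
    using assms one_le_exp_iff[of "4 / \<epsilon>"] unfolding b_def by (simp_all del: one_le_exp_iff)
  have "filterlim (\<lambda>x. x / b) at_top at_top"
    using b filterlim_tendsto_pos_mult_at_top[OF tendsto_const[of "1 / b"] _ filterlim_ident] by simp
  from eventually_compose_filterlim[OF slowly_varying_ratio_bounds[OF sv b(1)] this]
  show ?thesis
    using eventually_ge_at_top[of b]
  proof eventually_elim
    case (elim x)
    let ?y = "x / b"
    have y: "?y \<ge> 1" "?y \<le> x" using elim b by (auto simp: field_simps)
    have lb: "f x / 4 \<le> f (real j)" if "?y < real j" "real j \<le> x" for j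
    proof -
      \<comment> \<open>Both values are compared with the left endpoint \<open>?y\<close>, which
        costs one factor 2 each.\<close>
      have "f ?y \<le> 2 * f (real j)" "f x \<le> 2 * f ?y" using elim(1) that y b by auto
      then show ?thesis by simp
    qed
    have "f x / \<epsilon> = f x / 4 * ln (x / (2 * ?y))" using b elim by simp
    also have "\<dots> \<le> f x / 4 * ln (x / (?y + 1))"
    proof (intro mult_left_mono ln_mono divide_left_mono)
      show "?y + 1 \<le> 2 * ?y" using y(1) by linarith
      have "2 * ?y > 0" "?y + 1 > 0" "x > 0" using y elim b by linarith+
      then show "0 < x / (2 * ?y)" "0 < 2 * ?y * (?y + 1)" by (auto simp del: times_divide_eq_right)
    qed (use y elim b slowly_varying_pos[OF sv, of x] in auto)
    also have "\<dots> \<le> f x / 4 * (\<Sum>j | ?y < real j \<and> real j \<le> x. 1 / real j)"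
      using y slowly_varying_pos[OF sv, of x] by (intro mult_left_mono ln_le_sum_inverse) auto
    also have "\<dots> \<le> (\<Sum>j | ?y < real j \<and> real j \<le> x. f (real j) / real j)"
      unfolding sum_distrib_left
    proof (rule sum_mono)
      fix j assume "j \<in> {j. ?y < real j \<and> real j \<le> x}"
      then show "f x / 4 * (1 / real j) \<le> f (real j) / real j"
        using divide_right_mono[OF lb, of j "real j"] by simp
    qed
    also have "\<dots> = L f x - L f ?y" using y by (subst L_diff_eq) auto
    also have "\<dots> \<le> L f x" using slowly_varying_term_nonneg[OF sv]
      by (simp add: L_def sum_nonneg)
    finally show ?case using assms by (simp add: field_simps)
  qed
qed

text \<open>There are at most \<open>b * x\<close> new terms, each at most
  \<open>2 * f x / x\<close> by linear growth. Their total \<open>2 * b * f x\<close> is negligible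
  because \<open>f\<close> is of smaller order than \<open>L f\<close>.\<close>

lemma L_increment_le:
  assumes sv: "slowly_varying f" and "b \<ge> 1" "\<epsilon> > 0"
  shows "\<forall>\<^sub>F x in at_top. L f (b * x) \<le> (1 + \<epsilon>) * L f x"
proof -
  have "\<epsilon> / (2 * b) > 0" using assms by auto
  from slowly_varying_le_L[OF sv this] slowly_varying_growth[OF sv] eventually_ge_at_top[of 1]
  show ?thesis
  proof eventually_elim
    case (elim x)
    have pos: "f x > 0" using slowly_varying_pos[OF sv] elim by auto
    let ?J = "{j. x < real j \<and> real j \<le> b * x}"
    have bx: "x \<le> b * x" using elim assms by auto
    have "f (real j) / real j \<le> 2 * f x / x" if "x < real j" for j
    proof -
      have "f (real j) \<le> 2 * (real j / x) * f x" using elim that by auto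
      then show ?thesis using elim that by (simp add: field_simps)
    qed
    then have "L f (b * x) - L f x \<le> of_nat (card ?J) * (2 * f x / x)"
      using elim bx L_diff_eq[of x "b * x" f]
        sum_bounded_above[of ?J "\<lambda>j. f (real j) / real j" "2 * f x / x"] by simp
    also have "\<dots> \<le> b * x * (2 * f x / x)"
    proof (rule mult_right_mono)
      have "card ?J \<le> card {1..nat \<lfloor>b * x\<rfloor>}"
        using elim by (intro card_mono) (auto simp: le_nat_floor)
      then have "real (card ?J) \<le> real (nat \<lfloor>b * x\<rfloor>)" by simp
      also have "\<dots> \<le> b * x" using bx elim by (intro of_nat_floor) auto
      finally show "real (card ?J) \<le> b * x" .
    qed (use pos elim in auto)
    also have "\<dots> = 2 * b * f x" using elim by simp
    also have "\<dots> \<le> 2 * b * (\<epsilon> / (2 * b) * L f x)" using elim assms by (intro mult_left_mono) auto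
    also have "\<dots> = \<epsilon> * L f x" using assms by simp
    finally show ?case by (simp add: algebra_simps)
  qed
qed

text \<open>Linear growth of \<open>f\<close> cancels the factor \<open>1 / j\<close>, leaving
  \<open>2 * f x / x\<close> times a geometric series with sum at most \<open>x\<close>. The bound
  is uniform in \<open>M\<close>, so any cutoff of the sum is covered.\<close>

lemma sum_exp_tail_le:
  assumes sv: "slowly_varying f"
  shows "\<forall>\<^sub>F x in at_top. \<forall>M. (\<Sum>j | x < real j \<and> real j \<le> M. exp (- real j / x) * (f (real j) / real j)) \<le> 2 * f x"
  using slowly_varying_growth[OF sv] eventually_ge_at_top[of 1]
proof eventually_elim
  case (elim x)
  have pos: "f x > 0" using slowly_varying_pos[OF sv] elim by auto
  define r where "r = exp (- 1 / x)"
  have r: "0 < r" "r < 1" using elim by (auto simp: r_def)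
  have rj: "exp (- real j / x) = r ^ j" for j
    by (simp add: r_def exp_of_nat_mult[symmetric])
  have geo: "(\<Sum>j\<in>{1..n}. r ^ j) \<le> x" for n
  proof -
    have "(\<Sum>j\<in>{1..n}. r ^ j) = r * (\<Sum>j<n. r ^ j)"
      by (simp add: sum_distrib_left lessThan_atLeast0 sum.shift_bounds_Suc_ivl[symmetric] atLeastLessThanSuc_atLeastAtMost flip: power_Suc)
    also have "\<dots> = r * ((1 - r ^ n) / (1 - r))" using r by (simp add: sum_gp_strict)
    also have "\<dots> \<le> r * (1 / (1 - r))" using r by (intro mult_left_mono divide_right_mono) auto
    \<comment> \<open>The left side equals \<open>1 / (exp (1 / x) - 1)\<close>.\<close>
    also have "\<dots> \<le> x"
    proof -
      have "1 + 1 / x \<le> exp (1 / x)" by (rule exp_ge_add_one_self)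
      then have "r * (1 + 1 / x) \<le> r * exp (1 / x)" using r by (intro mult_left_mono) auto
      also have "\<dots> = 1" by (simp add: r_def flip: exp_add)
      finally show ?thesis using r elim by (simp add: field_simps)
    qed
    finally show ?thesis .
  qed
  show ?case
  proof
    fix M
    have "(\<Sum>j | x < real j \<and> real j \<le> M. exp (- real j / x) * (f (real j) / real j))
        \<le> (\<Sum>j | x < real j \<and> real j \<le> M. 2 * f x / x * r ^ j)"
    proof (rule sum_mono)
      fix j assume j: "j \<in> {j. x < real j \<and> real j \<le> M}"
      then have "f (real j) \<le> 2 * (real j / x) * f x" using elim by auto
      then have "f (real j) / real j \<le> 2 * f x / x" using elim j by (simp add: field_simps)
      then have "r ^ j * (f (real j) / real j) \<le> r ^ j * (2 * f x / x)"
        using r by (intro mult_left_mono) auto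
      then show "exp (- real j / x) * (f (real j) / real j) \<le> 2 * f x / x * r ^ j"
        unfolding rj by (simp add: mult.commute)
    qed
    also have "\<dots> \<le> (\<Sum>j\<in>{1..nat \<lfloor>M\<rfloor>}. 2 * f x / x * r ^ j)"
      using elim pos r by (intro sum_mono2) (auto simp: le_nat_floor)
    also have "\<dots> \<le> 2 * f x / x * x"
      unfolding sum_distrib_left[symmetric] using elim pos geo by (intro mult_left_mono) auto
    finally show "(\<Sum>j | x < real j \<and> real j \<le> M. exp (- real j / x) * (f (real j) / real j)) \<le> 2 * f x"
      using elim by simp
  qed
qed

section \<open>Criteria for a ratio to tend to 1\<close>

lemma L_filterlim_pos:
  assumes "filterlim (L f) at_top at_top" "filterlim g at_top F"
  shows "\<forall>\<^sub>F n in F. L f (g n) > 0"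
  using filterlim_compose[OF assms] by (simp add: filterlim_at_top_dense)

lemma tendsto_1_if_eventually_bounds:
  fixes u v :: "'a \<Rightarrow> real"
  assumes pos: "\<forall>\<^sub>F n in F. v n > 0"
    and lower: "\<And>\<epsilon>. 0 < \<epsilon> \<Longrightarrow> \<epsilon> < 1 \<Longrightarrow> \<forall>\<^sub>F n in F. (1 - \<epsilon>) * v n \<le> u n"
    and upper: "\<And>\<epsilon>. 0 < \<epsilon> \<Longrightarrow> \<epsilon> < 1 \<Longrightarrow> \<forall>\<^sub>F n in F. u n \<le> (1 + \<epsilon>) * v n"
  shows "((\<lambda>n. u n / v n) \<longlongrightarrow> 1) F"
proof (rule tendstoI)
  fix e :: real assume "e > 0"
  define \<epsilon> where "\<epsilon> = min 1 e / 2"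
  have \<epsilon>: "0 < \<epsilon>" "\<epsilon> < 1" "\<epsilon> < e" using \<open>e > 0\<close> by (auto simp: \<epsilon>_def)
  show "\<forall>\<^sub>F n in F. dist (u n / v n) 1 < e"
    using pos lower[OF \<epsilon>(1,2)] upper[OF \<epsilon>(1,2)]
  proof eventually_elim
    case (elim n)
    then have "1 - \<epsilon> \<le> u n / v n" "u n / v n \<le> 1 + \<epsilon>" by (auto simp: field_simps)
    then show ?case using \<epsilon> by (auto simp: dist_real_def)
  qed
qed

lemma tendsto_ratio_1:
  fixes u v w :: "'a \<Rightarrow> real"
  assumes "\<forall>\<^sub>F n in F. w n > 0"
    and "((\<lambda>n. u n / w n) \<longlongrightarrow> 1) F" "((\<lambda>n. v n / w n) \<longlongrightarrow> 1) F"
  shows "((\<lambda>n. u n / v n) \<longlongrightarrow> 1) F"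
proof (rule Lim_transform_eventually)
  show "((\<lambda>n. (u n / w n) / (v n / w n)) \<longlongrightarrow> 1) F"
    using tendsto_divide[OF assms(2,3)] by simp
  show "\<forall>\<^sub>F n in F. (u n / w n) / (v n / w n) = u n / v n"
    using assms(1) by eventually_elim simp
qed

section \<open>Bounds on \<open>Q\<close> and its asymptotics in terms of the minimum\<close>

lemma Q_eq:
  assumes "c > 0"
  shows "Q f lam N c =
    (\<Sum>j | 1 \<le> j \<and> real j \<le> real N * c. exp (- lam N * real j) * (f (real j) / real j))"
proof -
  have "{1..nat \<lfloor>real N * c\<rfloor>} = {j. 1 \<le> j \<and> real j \<le> real N * c}"
    using assms by (auto simp: le_nat_iff le_floor_iff)
  then show ?thesis by (simp add: Q_def)
qed

text \<open>For \<open>j \<le> \<delta> * m\<close> the exponent \<open>lam N * j\<close> is at most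
  \<open>\<delta>\<close>, and \<open>\<delta> \<le> c\<close> keeps these \<open>j\<close> within
  the range of \<open>Q\<close>.\<close>

lemma Q_lower:
  assumes sv: "slowly_varying f" and "N \<ge> 1" "lam N > 0" "0 \<le> \<delta>" "\<delta> \<le> c" "c > 0"
    and m: "m = min (real N) (inverse (lam N))"
  shows "exp (- \<delta>) * L f (\<delta> * m) \<le> Q f lam N c"
proof -
  have "\<delta> * m \<le> c * real N" using assms by (intro mult_mono) auto
  then have sub: "{j. 1 \<le> j \<and> real j \<le> \<delta> * m} \<subseteq> {j. 1 \<le> j \<and> real j \<le> real N * c}"
    by (auto simp: mult.commute)
  have "exp (- \<delta>) * L f (\<delta> * m)
      \<le> (\<Sum>j | 1 \<le> j \<and> real j \<le> \<delta> * m. exp (- lam N * real j) * (f (real j) / real j))"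
    unfolding L_def sum_distrib_left
  proof (rule sum_mono)
    fix j assume "j \<in> {j. 1 \<le> j \<and> real j \<le> \<delta> * m}"
    then have "real j \<le> \<delta> * inverse (lam N)"
      using m assms by (auto intro: order_trans[OF _ mult_left_mono[of m "inverse (lam N)" \<delta>]])
    then have "lam N * real j \<le> \<delta>" using assms by (simp add: field_simps)
    then show "exp (- \<delta>) * (f (real j) / real j) \<le> exp (- lam N * real j) * (f (real j) / real j)"
      using slowly_varying_term_nonneg[OF sv] by (intro mult_right_mono) auto
  qed
  also have "\<dots> \<le> Q f lam N c"
    unfolding Q_eq[OF \<open>c > 0\<close>] using sub slowly_varying_term_nonneg[OF sv]
    by (intro sum_mono2 finite_nats_below) (auto intro!: mult_nonneg_nonneg simp del: times_divide_eq_right)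
  finally show ?thesis .
qed

lemma Q_le_L:
  assumes sv: "slowly_varying f" and "lam N > 0" "c > 0"
  shows "Q f lam N c \<le> L f (c * real N)"
  unfolding Q_eq[OF \<open>c > 0\<close>] L_def mult.commute[of c]
  using assms slowly_varying_term_nonneg[OF sv]
  by (intro sum_mono mult_left_le_one_le) auto

text \<open>The sum is cut at \<open>1 / lam N\<close>: before the cut the weights are at most 1,
  after it the damped tail bound applies.\<close>

lemma Q_le_L_plus_tail:
  assumes sv: "slowly_varying f" and "lam N > 0" "c > 0"
    and tail: "\<And>M. (\<Sum>j | x < real j \<and> real j \<le> M. exp (- real j / x) * (f (real j) / real j)) \<le> 2 * f x"
    and x: "x = inverse (lam N)"
  shows "Q f lam N c \<le> L f x + 2 * f x"
proof -
  let ?g = "\<lambda>j. exp (- lam N * real j) * (f (real j) / real j)"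
  let ?A = "{j. 1 \<le> j \<and> real j \<le> x}" and ?B = "{j. x < real j \<and> real j \<le> real N * c}"
  have nn: "?g j \<ge> 0" for j
    using slowly_varying_term_nonneg[OF sv] by (intro mult_nonneg_nonneg) auto
  \<comment> \<open>Only an inequality: if \<open>real N * c < x\<close>, then \<open>?A\<close> may
    reach beyond the range of \<open>Q\<close>, and the extra terms are nonnegative.\<close>
  have "Q f lam N c \<le> sum ?g (?A \<union> ?B)"
    unfolding Q_eq[OF \<open>c > 0\<close>] using nn
    by (intro sum_mono2) (auto simp: finite_nats_below)
  also have "\<dots> = sum ?g ?A + sum ?g ?B"
    by (intro sum.union_disjoint) (auto simp: finite_nats_below)
  also have "sum ?g ?A \<le> L f x"
    unfolding L_def using assms slowly_varying_term_nonneg[OF sv]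
    by (intro sum_mono mult_left_le_one_le) auto
  also have "sum ?g ?B \<le> 2 * f x"
    using tail[of "real N * c"] unfolding x by (simp add: field_simps)
  finally show ?thesis by simp
qed

text \<open>Which of \<open>N\<close> and \<open>1 / lam N\<close> is the minimum is decided for
  each \<open>N\<close> separately, so a single limit covers every behaviour of
  \<open>N * lam N\<close>.\<close>

lemma Q_asymp_L_min:
  assumes sv: "slowly_varying f" and L_inf: "filterlim (L f) at_top at_top"
    and lam_pos: "\<And>N. N \<ge> 1 \<Longrightarrow> lam N > 0"
    and m_inf: "filterlim (\<lambda>N. min (real N) (inverse (lam N))) at_top sequentially"
    and "c > 0"
  shows "(\<lambda>N. Q f lam N c / L f (min (real N) (inverse (lam N)))) \<longlonglongrightarrow> 1"
proof (rule tendsto_1_if_eventually_bounds)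
  define m where "m = (\<lambda>N. min (real N) (inverse (lam N)))"
  have m_fold: "min (real N) (inverse (lam N)) = m N" for N by (simp add: m_def)
  have m_inf: "filterlim m at_top sequentially" using m_inf by (simp add: m_def)
  note ev_m = eventually_compose_filterlim[OF _ m_inf]
  show pos: "\<forall>\<^sub>F N in sequentially. L f (min (real N) (inverse (lam N))) > 0"
    using L_filterlim_pos[OF L_inf assms(4)] .
  fix \<epsilon> :: real assume \<epsilon>: "0 < \<epsilon>" "\<epsilon> < 1"
  show "\<forall>\<^sub>F N in sequentially. (1 - \<epsilon>) * L f (min (real N) (inverse (lam N))) \<le> Q f lam N c"
  proof -
    \<comment> \<open>Two losses occur: \<open>exp (- \<delta>) \<ge> 1 - \<delta>\<close> and the
      factor \<open>1 + \<delta>\<close> between \<open>L\<close> at \<open>m\<close> and at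
      \<open>\<delta> * m\<close>. Together they stay within
      \<open>1 - 2 * \<delta> \<ge> 1 - \<epsilon>\<close>.\<close>
    define \<delta> where "\<delta> = min c (\<epsilon> / 2)"
    have \<delta>: "0 < \<delta>" "\<delta> \<le> 1" "\<delta> \<le> c" "2 * \<delta> \<le> \<epsilon>" using \<epsilon> \<open>c > 0\<close> by (auto simp: \<delta>_def)
    have "filterlim (\<lambda>N. \<delta> * m N) at_top sequentially"
      using \<delta> m_inf by (intro filterlim_tendsto_pos_mult_at_top[OF tendsto_const])
    moreover have "\<forall>\<^sub>F x in at_top. L f (1 / \<delta> * x) \<le> (1 + \<delta>) * L f x"
      using \<delta> by (intro L_increment_le[OF sv]) auto
    ultimately have "\<forall>\<^sub>F N in sequentially. L f (1 / \<delta> * (\<delta> * m N)) \<le> (1 + \<delta>) * L f (\<delta> * m N)"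
      using eventually_compose_filterlim by blast
    then show ?thesis using pos eventually_ge_at_top[of 1] unfolding m_fold
    proof eventually_elim
      case (elim N)
      have L: "L f (m N) \<le> (1 + \<delta>) * L f (\<delta> * m N)" using elim \<delta> by simp
      have "(1 - \<epsilon>) * L f (m N) \<le> (1 - 2 * \<delta>) * L f (m N)"
        using \<delta> elim by (intro mult_right_mono) (auto simp: m_def)
      also have "\<dots> \<le> (1 - \<delta>) / (1 + \<delta>) * L f (m N)"
        using \<delta> elim by (intro mult_right_mono) (auto simp: m_def field_simps)
      also have "\<dots> \<le> (1 - \<delta>) / (1 + \<delta>) * ((1 + \<delta>) * L f (\<delta> * m N))"
        using L \<delta> by (intro mult_left_mono) auto
      also have "\<dots> = (1 - \<delta>) * L f (\<delta> * m N)" using \<delta> by simp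
      also have "\<dots> \<le> exp (- \<delta>) * L f (\<delta> * m N)"
        using exp_ge_add_one_self[of "- \<delta>"] slowly_varying_term_nonneg[OF sv]
        by (intro mult_right_mono) (auto simp: L_def sum_nonneg)
      also have "\<dots> \<le> Q f lam N c"
        using elim \<delta> assms by (intro Q_lower) (auto simp: m_def)
      finally show ?case .
    qed
  qed
  show "\<forall>\<^sub>F N in sequentially. Q f lam N c \<le> (1 + \<epsilon>) * L f (min (real N) (inverse (lam N)))"
  proof -
    \<comment> \<open>The increment bound needs a factor at least 1, hence the maximum. The
      tolerance \<open>\<epsilon> / 3\<close> leaves room for the tail, which costs
      \<open>2 * f (m N)\<close>.\<close>
    define K where "K = max c 1"
    have "\<epsilon> / 3 > 0" "K \<ge> 1" using \<epsilon> by (auto simp: K_def)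
    note bounds = ev_m[OF L_increment_le[OF sv this(2,1)]] ev_m[OF slowly_varying_le_L[OF sv this(1)]]
      ev_m[OF sum_exp_tail_le[OF sv]]
    then show ?thesis using pos eventually_ge_at_top[of 1] unfolding m_fold
    proof eventually_elim
      case (elim N)
      have lam: "lam N > 0" using lam_pos elim by auto
      have "m N > 0" using lam elim by (auto simp: m_def)
      show ?case
      proof (cases "real N \<le> inverse (lam N)")
        case True
        then have m: "m N = real N" by (simp add: m_def)
        have "Q f lam N c \<le> L f (c * m N)" using Q_le_L[of f lam N c, OF sv lam \<open>c > 0\<close>] m by simp
        also have "\<dots> \<le> L f (K * m N)"
          using \<open>m N > 0\<close> by (intro L_mono[OF sv] mult_right_mono) (auto simp: K_def)
        also have "\<dots> \<le> (1 + \<epsilon> / 3) * L f (m N)" using elim by auto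
        also have "\<dots> \<le> (1 + \<epsilon>) * L f (m N)"
          using elim \<epsilon> by (intro mult_right_mono) (auto simp: m_def)
        finally show ?thesis .
      next
        case False
        then have "m N = inverse (lam N)" by (simp add: m_def)
        then have "Q f lam N c \<le> L f (m N) + 2 * f (m N)"
          using elim by (intro Q_le_L_plus_tail sv lam \<open>c > 0\<close>) auto
        also have "\<dots> \<le> L f (m N) + 2 * (\<epsilon> / 3 * L f (m N))" using elim by auto
        also have "\<dots> = (1 + 2 / 3 * \<epsilon>) * L f (m N)" by (simp add: algebra_simps)
        also have "\<dots> \<le> (1 + \<epsilon>) * L f (m N)"
          using elim \<epsilon> by (intro mult_right_mono) (auto simp: m_def)
        finally show ?thesis .
      qed
    qed
  qed
qed

section \<open>Passage from the minimum to the separate regimes\<close>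

theorem theorem1p4:
  fixes ell :: "real \<Rightarrow> real" and lam :: "nat \<Rightarrow> real" and lamstar :: ennreal
  assumes sv: "slowly_varying ell"
    and lb: "locally_bounded_on {1..} ell"
    and L_inf: "filterlim (L ell) at_top at_top"
    and lam_pos: "\<And>N. N \<ge> 1 \<Longrightarrow> lam N > 0"
    and lam_0: "lam \<longlonglongrightarrow> 0"
    and lam_star: "(\<lambda>N. ennreal (real N * lam N)) \<longlonglongrightarrow> lamstar"
  shows "(\<forall>c>0. (\<lambda>N. Q ell lam N c / Q ell lam N 1) \<longlonglongrightarrow> 1)
    \<and> (lamstar < \<infinity> \<longrightarrow> (\<lambda>N. Q ell lam N 1 / L ell (real N)) \<longlonglongrightarrow> 1)
    \<and> (lamstar = \<infinity> \<longrightarrow> (\<lambda>N. Q ell lam N 1 / L ell (1 / lam N)) \<longlonglongrightarrow> 1)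
    \<and> (\<lambda>N. Q ell lam N 1 / L ell (min (real N) (inverse (lam N)))) \<longlonglongrightarrow> 1"
proof -
  define m where "m = (\<lambda>N. min (real N) (inverse (lam N)))"
  have ev_pos: "\<forall>\<^sub>F N in sequentially. lam N > 0"
    using eventually_ge_at_top[of 1] by eventually_elim (rule lam_pos)
  have "filterlim (\<lambda>N. inverse (lam N)) at_top sequentially"
    using filterlim_inverse_at_top[OF lam_0 ev_pos] .
  then have m_inf: "filterlim m at_top sequentially"
    using filterlim_real_sequentially unfolding m_def filterlim_at_top
    by (auto intro: eventually_conj)
  have Lm_pos: "\<forall>\<^sub>F N in sequentially. L ell (m N) > 0"
    by (rule L_filterlim_pos[OF L_inf m_inf])
  have Q_m: "(\<lambda>N. Q ell lam N c / L ell (m N)) \<longlonglongrightarrow> 1" if "c > 0" for c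
    using m_inf that unfolding m_def by (intro Q_asymp_L_min sv L_inf lam_pos)

  have "(\<lambda>N. Q ell lam N c / Q ell lam N 1) \<longlonglongrightarrow> 1" if "c > 0" for c
    using tendsto_ratio_1[OF Lm_pos Q_m[OF that] Q_m[of 1]] by simp
  moreover have "(\<lambda>N. Q ell lam N 1 / L ell (real N)) \<longlonglongrightarrow> 1" if fin: "lamstar < \<infinity>"
  proof -
    \<comment> \<open>\<open>K\<close> strictly exceeds the limit, hence eventually bounds
      \<open>N * lam N\<close>; \<open>K \<ge> 1\<close> makes \<open>N \<le> K * m N\<close> hold
      also where \<open>m N = N\<close>.\<close>
    obtain K where K: "K \<ge> 1" "lamstar < ennreal K"
    proof
      show "lamstar < ennreal (enn2real lamstar + 1)"
        using fin by (cases lamstar) (auto simp: ennreal_less_iff simp flip: ennreal_1 ennreal_plus)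
    qed auto
    have "\<forall>\<^sub>F N in sequentially. real N * lam N < K"
      using order_tendstoD(2)[OF lam_star K(2)]
      by eventually_elim (use K(1) in \<open>auto simp: ennreal_less_iff ennreal_lessI intro: ccontr\<close>)
    then have N_le: "\<forall>\<^sub>F N in sequentially. real N \<le> K * m N" using ev_pos
    proof eventually_elim
      case (elim N)
      then show ?case using K(1) mult_right_mono[of 1 K "real N"] by (auto simp: m_def min_def field_simps)
    qed
    \<comment> \<open>Eventually \<open>m N \<le> N \<le> K * m N\<close>, and \<open>L\<close> does
      not distinguish these scales asymptotically.\<close>
    have "(\<lambda>N. L ell (real N) / L ell (m N)) \<longlonglongrightarrow> 1"
    proof (rule tendsto_1_if_eventually_bounds[OF Lm_pos])
      fix \<epsilon> :: real assume \<epsilon>: "0 < \<epsilon>" "\<epsilon> < 1"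
      show "\<forall>\<^sub>F N in sequentially. (1 - \<epsilon>) * L ell (m N) \<le> L ell (real N)"
        using Lm_pos
      proof eventually_elim
        case (elim N)
        have "L ell (m N) \<le> L ell (real N)" by (intro L_mono[OF sv]) (auto simp: m_def)
        then show ?case using elim \<epsilon> mult_right_mono[of "1 - \<epsilon>" 1 "L ell (m N)"] by linarith
      qed
      show "\<forall>\<^sub>F N in sequentially. L ell (real N) \<le> (1 + \<epsilon>) * L ell (m N)"
        using eventually_compose_filterlim[OF L_increment_le[OF sv K(1) \<epsilon>(1)] m_inf] N_le
        by eventually_elim (auto intro: order_trans[OF L_mono[OF sv]])
    qed
    then show ?thesis by (intro tendsto_ratio_1[OF Lm_pos Q_m[of 1]]) simp
  qed
  moreover have "(\<lambda>N. Q ell lam N 1 / L ell (1 / lam N)) \<longlonglongrightarrow> 1" if "lamstar = \<infinity>"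
  proof -
    \<comment> \<open>Once \<open>N * lam N > 1\<close>, the minimum is exactly
      \<open>1 / lam N\<close>.\<close>
    have "\<forall>\<^sub>F N in sequentially. ennreal (real N * lam N) > 1"
      using order_tendstoD(1)[OF lam_star, of 1] that by simp
    then have "\<forall>\<^sub>F N in sequentially. m N = 1 / lam N" using ev_pos
      by eventually_elim (auto simp: m_def min_def field_simps)
    then have "\<forall>\<^sub>F N in sequentially. Q ell lam N 1 / L ell (m N) = Q ell lam N 1 / L ell (1 / lam N)"
      by eventually_elim simp
    then show ?thesis by (rule Lim_transform_eventually[OF Q_m[of 1], rotated]) simp
  qed
  ultimately show ?thesis using Q_m[of 1] by (auto simp: m_def)
qed

end
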